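(* Let $\mathbf{A}=\langle A,\vee,1\rangle$ be a distributive nearlattice and let $\rho$ be the map $x\mapsto x^{\top}$ from $A$ to the set $\mathrm{R}(A)=\{a^{\top}\colon a\in A\}$. Then the following conditions are equivalent: (1) $\rho$ is injective, i.e. for all $a,b\in A$, $a^{\top}=b^{\top}$ implies $a=b$; (2) every filter of $A$ is an $\alpha$-filter; (3) every prime filter of $A$ is an $\alpha$-filter.
   Context: A distributive nearlattice is a join-semilattice $\langle A,\vee,1\rangle$ with greatest element $1$ in which every principal filter $[a)=\{x\in A\colon a\le x\}$ is a bounded distributive lattice (with the induced order). A filter of $A$ is a subset $F\subseteq A$ with $1\in F$, which is upward closed, and such that $a,b\in F$ implies $a\wedge b\in F$ whenever the meet $a\wedge b$ exists in $A$. A filter $F$ is prime if $a\vee b\in F$ implies $a\in F$ or $b\in F$. For $a\in A$, the annihilator of $a$ is $a^{\top}=\{x\in A\colon x\vee a=1\}$, and $a^{\top\top}=\{y\in A\colon y\vee x=1 \text{ for all } x\in a^{\top}\}$. A filter $F$ is an $\alpha$-filter if $a^{\top\top}\subseteq F$ for every $a\in F$. *)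

theory Defs
  imports "HOL-Algebra.Lattice"
begin

locale bounded_distributive_lattice = bounded_lattice +
  assumes meet_join_distrib:
    "\<lbrakk>x \<in> carrier L; y \<in> carrier L; z \<in> carrier L\<rbrakk>
      \<Longrightarrow> x \<sqinter> (y \<squnion> z) = (x \<sqinter> y) \<squnion> (x \<sqinter> z)"

definition principal_filter :: "('a, 'b) gorder_scheme \<Rightarrow> 'a \<Rightarrow> 'a set"
  where "principal_filter L a = {x \<in> carrier L. a \<sqsubseteq>\<^bsub>L\<^esub> x}"

text \<open>
  The join-semilattice is given by its order; \<open>\<or>\<close> is the join \<open>\<squnion>\<close> and \<open>1\<close> is \<open>\<top>\<close>.
  The record update restricts the order to the principal filter, so the lattice operations
  required there are computed inside the principal filter.
\<close>

locale distributive_nearlattice = upper_semilattice + weak_partial_order_top +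
  assumes principal_filter_lattice:
    "a \<in> carrier L \<Longrightarrow> bounded_distributive_lattice (L\<lparr>carrier := principal_filter L a\<rparr>)"

text \<open>
  In a nearlattice the meet is only partial, and the library's total operation \<open>\<sqinter>\<close> is
  unspecified where no greatest lower bound exists; hence closure under existing meets is
  phrased with \<^const>\<open>greatest\<close> and \<^const>\<open>Lower\<close>.
\<close>

definition nearlattice_filter :: "('a, 'b) gorder_scheme \<Rightarrow> 'a set \<Rightarrow> bool"
  where "nearlattice_filter L F \<longleftrightarrow>
    F \<subseteq> carrier L \<and>
    \<top>\<^bsub>L\<^esub> \<in> F \<and>
    (\<forall>a\<in>F. \<forall>b\<in>carrier L. a \<sqsubseteq>\<^bsub>L\<^esub> b \<longrightarrow> b \<in> F) \<and>
    (\<forall>a\<in>F. \<forall>b\<in>F. \<forall>m. greatest L m (Lower L {a, b}) \<longrightarrow> m \<in> F)"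

text \<open>Primeness does not include properness: the whole carrier counts as a prime filter.\<close>

definition prime_nearlattice_filter :: "('a, 'b) gorder_scheme \<Rightarrow> 'a set \<Rightarrow> bool"
  where "prime_nearlattice_filter L F \<longleftrightarrow>
    nearlattice_filter L F \<and>
    (\<forall>a\<in>carrier L. \<forall>b\<in>carrier L. a \<squnion>\<^bsub>L\<^esub> b \<in> F \<longrightarrow> a \<in> F \<or> b \<in> F)"

definition annihilator :: "('a, 'b) gorder_scheme \<Rightarrow> 'a \<Rightarrow> 'a set"
  where "annihilator L a = {x \<in> carrier L. x \<squnion>\<^bsub>L\<^esub> a = \<top>\<^bsub>L\<^esub>}"

definition double_annihilator :: "('a, 'b) gorder_scheme \<Rightarrow> 'a \<Rightarrow> 'a set"
  where "double_annihilator L a =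
    {y \<in> carrier L. \<forall>x\<in>annihilator L a. y \<squnion>\<^bsub>L\<^esub> x = \<top>\<^bsub>L\<^esub>}"

definition alpha_filter :: "('a, 'b) gorder_scheme \<Rightarrow> 'a set \<Rightarrow> bool"
  where "alpha_filter L F \<longleftrightarrow>
    nearlattice_filter L F \<and> (\<forall>a\<in>F. double_annihilator L a \<subseteq> F)"

end

theory Submission
  imports Defs
begin

text \<open>
  If \<open>b \<in> a\<^sup>\<top>\<^sup>\<top>\<close>, that is \<open>a\<^sup>\<top> \<subseteq> b\<^sup>\<top>\<close>, then \<open>(a \<squnion> b)\<^sup>\<top> = b\<^sup>\<top>\<close>; injectivity gives
  \<open>a \<squnion> b = b\<close>, so every filter containing \<open>a\<close> contains \<open>b\<close>. Conversely, if
  \<open>a\<^sup>\<top> = b\<^sup>\<top>\<close> but \<open>a \<sqsubseteq> b\<close> fails, some prime filter contains \<open>a\<close> and omits \<open>b \<in> a\<^sup>\<top>\<^sup>\<top>\<close>, so it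
  is not an \<open>\<alpha>\<close>-filter. Separation by prime filters avoids describing generated filters
  and uses the residual filters \<open>{z. z \<squnion> y \<in> F}\<close> instead.
\<close>

section \<open>Filter closure rules and join identities\<close>

lemma nearlattice_filter_closed:
  assumes "nearlattice_filter L F" "a \<in> F"
  shows "a \<in> carrier L"
  using assms unfolding nearlattice_filter_def by (elim conjE) (rule subsetD)

lemma nearlattice_filter_upward:
  assumes "nearlattice_filter L F" "a \<in> F" "b \<in> carrier L" "a \<sqsubseteq>\<^bsub>L\<^esub> b"
  shows "b \<in> F"
  using assms unfolding nearlattice_filter_def by meson

lemma nearlattice_filter_meet:
  assumes "nearlattice_filter L F" "a \<in> F" "b \<in> F" "greatest L m (Lower L {a, b})"
  shows "m \<in> F"
  using assms unfolding nearlattice_filter_def by meson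

lemma (in upper_semilattice) join_absorb:
  assumes "x \<sqsubseteq> y" "x \<in> carrier L" "y \<in> carrier L"
  shows "x \<squnion> y = y"
  using assms by (intro le_antisym join_le join_right join_closed le_refl)

lemma (in upper_semilattice) join_assoc:
  assumes "x \<in> carrier L" "y \<in> carrier L" "z \<in> carrier L"
  shows "(x \<squnion> y) \<squnion> z = x \<squnion> (y \<squnion> z)"
  using weak_join_assoc[OF assms] by (simp add: eq_is_equal)

section \<open>Distributivity inside principal filters\<close>

text \<open>Distributing \<open>u = u \<sqinter> (y \<squnion> z)\<close> reduces the claim to
  \<open>u \<sqinter> z \<sqsubseteq> y\<close>; the same argument for \<open>u \<sqinter> z\<close>
  and \<open>w\<close> reduces this to the last premise. It is the dual distributive law as an order
  test.\<close>

lemma (in bounded_distributive_lattice) le_if_le_joins: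
  assumes c: "u \<in> carrier L" "y \<in> carrier L" "z \<in> carrier L" "w \<in> carrier L"
    and uz: "u \<sqsubseteq> y \<squnion> z" and uw: "u \<sqsubseteq> y \<squnion> w" and zw: "z \<sqinter> w \<sqsubseteq> y"
  shows "u \<sqsubseteq> y"
proof -
  have expand: "v \<sqsubseteq> y" if v: "v \<in> carrier L" "t \<in> carrier L" "v \<sqsubseteq> y \<squnion> t" "v \<sqinter> t \<sqsubseteq> y" for v t
  proof -
    have "v = v \<sqinter> (y \<squnion> t)"
      using v c le_iff_join[of v "y \<squnion> t"] by simp
    also have "\<dots> = (v \<sqinter> y) \<squnion> (v \<sqinter> t)"
      using v c by (simp add: meet_join_distrib)
    also have "\<dots> \<sqsubseteq> y"
      using v c by (simp add: join_le meet_right)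
    finally show ?thesis .
  qed
  have "u \<sqinter> z \<sqsubseteq> u" "u \<sqinter> z \<sqsubseteq> z" "u \<sqinter> z \<in> carrier L"
    using c by (simp_all add: meet_left meet_right)
  moreover have "(u \<sqinter> z) \<sqinter> w \<sqsubseteq> z \<sqinter> w"
    using c calculation by (intro meet_le meet_closed) (auto intro: meet_left meet_right le_trans[OF meet_left])
  ultimately have "u \<sqinter> z \<sqsubseteq> y"
    using c uw zw by (intro expand[of "u \<sqinter> z" w]) (auto intro: le_trans)
  then show ?thesis
    using c uz by (intro expand[of u z])
qed

context distributive_nearlattice
begin

text \<open>Distributivity is available above \<open>m\<close>, but \<open>y\<close> and a lower
  bound \<open>u\<close> of the two joins need not lie there. They are replaced by
  \<open>m \<squnion> y\<close> and \<open>u \<squnion> m\<close>, which do.\<close>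

lemma meet_join_right:
  assumes c: "z \<in> carrier L" "w \<in> carrier L" "y \<in> carrier L"
    and m: "greatest L m (Lower L {z, w})"
  shows "greatest L (m \<squnion> y) (Lower L {z \<squnion> y, w \<squnion> y})"
proof -
  have mc: "m \<in> carrier L" and mz: "m \<sqsubseteq> z" and mw: "m \<sqsubseteq> w"
    using m c by (auto simp: greatest_def Lower_def)
  have mg: "t \<sqsubseteq> m" if "t \<in> carrier L" "t \<sqsubseteq> z" "t \<sqsubseteq> w" for t
    using m c that by (auto simp: greatest_def Lower_def)
  let ?S = "L\<lparr>carrier := principal_filter L m\<rparr>"
  interpret S: bounded_distributive_lattice ?S
    by (rule principal_filter_lattice[OF mc])
  have S_car: "t \<in> carrier ?S \<longleftrightarrow> t \<in> carrier L \<and> m \<sqsubseteq> t" for t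
    by (simp add: principal_filter_def)
  have S_le: "s \<sqsubseteq>\<^bsub>?S\<^esub> t \<longleftrightarrow> s \<sqsubseteq> t" for s t
    by simp
  have zS: "z \<in> carrier ?S" and wS: "w \<in> carrier ?S" and yS: "m \<squnion> y \<in> carrier ?S"
    using c mc mz mw by (simp_all only: S_car join_left join_closed)
  \<comment> \<open>Joins and meets of \<open>?S\<close> are formed in the restricted order, so they
    are compared with those of \<open>L\<close> only by the one-sided bounds needed here.\<close>
  have join_S: "v \<squnion> y \<sqsubseteq> (m \<squnion> y) \<squnion>\<^bsub>?S\<^esub> v" if v: "v \<in> carrier ?S" for v
  proof -
    let ?j = "(m \<squnion> y) \<squnion>\<^bsub>?S\<^esub> v"
    have "?j \<in> carrier L" "v \<sqsubseteq> ?j" "m \<squnion> y \<sqsubseteq> ?j"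
      using S.join_closed[OF yS v] S.join_left[OF yS v] S.join_right[OF yS v] S_car S_le by auto
    moreover have "y \<sqsubseteq> m \<squnion> y"
      using c mc by (simp add: join_right)
    ultimately show ?thesis
      using v c mc S_car by (meson join_closed join_le le_trans)
  qed
  have meet_S: "z \<sqinter>\<^bsub>?S\<^esub> w \<sqsubseteq> m \<squnion> y"
  proof -
    have "z \<sqinter>\<^bsub>?S\<^esub> w \<in> carrier L" "z \<sqinter>\<^bsub>?S\<^esub> w \<sqsubseteq> z" "z \<sqinter>\<^bsub>?S\<^esub> w \<sqsubseteq> w"
      using S.meet_closed[OF zS wS] S.meet_left[OF zS wS] S.meet_right[OF zS wS] S_car S_le by auto
    then show ?thesis
      using mg c mc by (meson join_closed join_left le_trans)
  qed
  have "u \<sqsubseteq> m \<squnion> y" if u: "u \<in> carrier L" "u \<sqsubseteq> z \<squnion> y" "u \<sqsubseteq> w \<squnion> y" for u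
  proof -
    have uS: "u \<squnion> m \<in> carrier ?S"
      using u mc by (simp only: S_car join_right join_closed)
    have le: "u \<squnion> m \<sqsubseteq> (m \<squnion> y) \<squnion>\<^bsub>?S\<^esub> v"
      if v: "v \<in> carrier ?S" "u \<sqsubseteq> v \<squnion> y" for v
    proof -
      have vL: "v \<in> carrier L" "m \<sqsubseteq> v" using v S_car by auto
      then have "u \<squnion> m \<sqsubseteq> v \<squnion> y"
        using v u mc c by (meson join_closed join_le join_left le_trans)
      then show ?thesis
        using join_S[OF v(1)] u mc c vL S.join_closed[OF yS v(1)] S_car
        by (meson join_closed le_trans)
    qed
    have "u \<squnion> m \<sqsubseteq>\<^bsub>?S\<^esub> m \<squnion> y"
      using S.le_if_le_joins[OF uS yS zS wS] le[OF zS u(2)] le[OF wS u(3)] meet_S S_le by blast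
    then show ?thesis
      using u mc c S_le by (meson join_closed join_left le_trans)
  qed
  moreover have "m \<squnion> y \<sqsubseteq> v \<squnion> y" if "v \<in> carrier L" "m \<sqsubseteq> v" for v
    using that c mc by (meson join_closed join_le join_left join_right le_trans)
  ultimately show ?thesis
    using c mc mz mw by (auto simp: greatest_def Lower_def)
qed

section \<open>Constructing filters and separating by prime filters\<close>

text \<open>Closure under meets is where distributivity enters: if \<open>m\<close> is the meet of
  \<open>a\<close> and \<open>b\<close>, then \<open>m \<squnion> y\<close> is the meet of two
  members of \<open>F\<close>.\<close>

lemma filter_residual:
  assumes F: "nearlattice_filter L F" and y: "y \<in> carrier L"
  shows "nearlattice_filter L {z \<in> carrier L. z \<squnion> y \<in> F}"
proof -
  have Ft: "\<top> \<in> F"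
    using F unfolding nearlattice_filter_def by (elim conjE)
  have up: "b \<squnion> y \<in> F" if "a \<in> carrier L" "a \<squnion> y \<in> F" "b \<in> carrier L" "a \<sqsubseteq> b" for a b
    using that y
    by (intro nearlattice_filter_upward[OF F that(2)]) (meson join_closed join_le join_left join_right le_trans)+
  show ?thesis
    unfolding nearlattice_filter_def
  proof (intro conjI ballI allI impI)
    show "{z \<in> carrier L. z \<squnion> y \<in> F} \<subseteq> carrier L"
      by (rule Collect_subset)
    show "\<top> \<in> {z \<in> carrier L. z \<squnion> y \<in> F}"
      using nearlattice_filter_upward[OF F Ft] y by (simp add: join_left)
  next
    fix a b
    assume "a \<in> {z \<in> carrier L. z \<squnion> y \<in> F}" "b \<in> carrier L" "a \<sqsubseteq> b"
    then show "b \<in> {z \<in> carrier L. z \<squnion> y \<in> F}"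
      using up[of a b] by simp
  next
    fix a b m
    assume "a \<in> {z \<in> carrier L. z \<squnion> y \<in> F}" "b \<in> {z \<in> carrier L. z \<squnion> y \<in> F}"
      and m: "greatest L m (Lower L {a, b})"
    then show "m \<in> {z \<in> carrier L. z \<squnion> y \<in> F}"
      using nearlattice_filter_meet[OF F _ _ meet_join_right[OF _ _ y m]] greatest_closed[OF m]
      by simp
  qed
qed

lemma subset_filter_residual:
  assumes F: "nearlattice_filter L F" and y: "y \<in> carrier L"
  shows "F \<subseteq> {z \<in> carrier L. z \<squnion> y \<in> F}"
proof
  fix z
  assume "z \<in> F"
  then show "z \<in> {z \<in> carrier L. z \<squnion> y \<in> F}"
    using y nearlattice_filter_closed[OF F, of z] nearlattice_filter_upward[OF F, of z "z \<squnion> y"]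
    by (simp add: join_left)
qed

lemma nearlattice_filter_principal_filter:
  assumes "a \<in> carrier L"
  shows "nearlattice_filter L (principal_filter L a)"
  unfolding nearlattice_filter_def principal_filter_def
proof (intro conjI ballI allI impI)
  fix x y
  assume "x \<in> {x \<in> carrier L. a \<sqsubseteq> x}" "y \<in> carrier L" "x \<sqsubseteq> y"
  then show "y \<in> {x \<in> carrier L. a \<sqsubseteq> x}"
    using assms le_trans[of a x y] by simp
next
  fix x y m
  assume "x \<in> {x \<in> carrier L. a \<sqsubseteq> x}" "y \<in> {x \<in> carrier L. a \<sqsubseteq> x}"
    "greatest L m (Lower L {x, y})"
  then show "m \<in> {x \<in> carrier L. a \<sqsubseteq> x}"
    using assms by (auto simp: greatest_def Lower_def)
qed (simp_all add: assms)

text \<open>Two elements of the union lie in a common member of the chain, which then contains their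
  meet if it exists. This is the chain condition for Zorn's lemma.\<close>

lemma nearlattice_filter_Union_chain:
  assumes "C \<noteq> {}" "\<And>F. F \<in> C \<Longrightarrow> nearlattice_filter L F" "subset.chain UNIV C"
  shows "nearlattice_filter L (\<Union>C)"
proof -
  have "\<exists>F\<in>C. a \<in> F \<and> b \<in> F" if ab: "a \<in> \<Union>C" "b \<in> \<Union>C" for a b
  proof -
    obtain F G where "F \<in> C" "a \<in> F" "G \<in> C" "b \<in> G"
      using ab by blast
    moreover from this have "F \<subseteq> G \<or> G \<subseteq> F"
      using assms(3) unfolding subset_chain_def by simp
    ultimately show ?thesis
      by blast
  qed
  then have "m \<in> \<Union>C" if "a \<in> \<Union>C" "b \<in> \<Union>C" "greatest L m (Lower L {a, b})" for a b m
    using nearlattice_filter_meet[OF assms(2) _ _ that(3)] that(1,2) by (meson UnionI)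
  moreover have "x \<in> carrier L" if "x \<in> \<Union>C" for x
    using that nearlattice_filter_closed[OF assms(2)] by (meson UnionE)
  moreover have "b \<in> \<Union>C" if "a \<in> \<Union>C" "b \<in> carrier L" "a \<sqsubseteq> b" for a b
    using nearlattice_filter_upward[OF assms(2) _ that(2,3)] that(1) by (meson UnionE UnionI)
  moreover have "\<top> \<in> \<Union>C"
    using assms(1,2) unfolding nearlattice_filter_def by (meson UnionI equals0I)
  ultimately show ?thesis
    unfolding nearlattice_filter_def by (intro conjI ballI allI impI subsetI)
qed

text \<open>
  A filter \<open>P\<close> maximal among those omitting \<open>b\<close> is prime: if \<open>x \<squnion> y \<in> P\<close> and \<open>x \<notin> P\<close>,
  maximality puts \<open>b\<close> into the strictly larger residual of \<open>P\<close> by \<open>y\<close>, that is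
  \<open>b \<squnion> y \<in> P\<close>; if also \<open>y \<notin> P\<close>, the residual by \<open>b\<close> then yields \<open>b = b \<squnion> b \<in> P\<close>.
\<close>

lemma prime_filter_separation:
  assumes a: "a \<in> carrier L" and b: "b \<in> carrier L" and nle: "\<not> a \<sqsubseteq> b"
  obtains P where "prime_nearlattice_filter L P" "a \<in> P" "b \<notin> P"
proof -
  let ?\<F> = "{F. nearlattice_filter L F \<and> a \<in> F \<and> b \<notin> F}"
  have "principal_filter L a \<in> ?\<F>"
    using nearlattice_filter_principal_filter[OF a] a nle by (simp add: principal_filter_def)
  moreover have "\<Union>C \<in> ?\<F>" if "C \<noteq> {}" "subset.chain ?\<F> C" for C
  proof -
    have "C \<subseteq> ?\<F>" "subset.chain UNIV C"
      using that(2) unfolding subset_chain_def by auto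
    then show ?thesis
      using nearlattice_filter_Union_chain[OF that(1)] that(1) by blast
  qed
  ultimately have "\<exists>M\<in>?\<F>. \<forall>X\<in>?\<F>. M \<subseteq> X \<longrightarrow> X = M"
    by (intro subset_Zorn_nonempty) (blast, assumption)
  then obtain P where P: "P \<in> ?\<F>" and max: "\<And>X. X \<in> ?\<F> \<Longrightarrow> P \<subseteq> X \<Longrightarrow> X = P"
    by auto
  have residual: "b \<squnion> y \<in> P" if "x \<in> carrier L" "y \<in> carrier L" "x \<squnion> y \<in> P" "x \<notin> P" for x y
  proof (rule ccontr)
    assume "b \<squnion> y \<notin> P"
    then have "{z \<in> carrier L. z \<squnion> y \<in> P} = P"
      using P subset_filter_residual filter_residual that(2) by (intro max) blast+
    then show False
      using that by blast
  qed
  have "x \<in> P \<or> y \<in> P" if xy: "x \<in> carrier L" "y \<in> carrier L" "x \<squnion> y \<in> P" for x y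
  proof (rule ccontr)
    assume "\<not> (x \<in> P \<or> y \<in> P)"
    then have "y \<squnion> b \<in> P" "y \<notin> P"
      using residual[OF xy] xy b by (auto simp: join_comm)
    then have "b \<squnion> b \<in> P"
      using residual xy b by blast
    then show False
      using P b by (simp add: join_absorb)
  qed
  then have "prime_nearlattice_filter L P"
    using P unfolding prime_nearlattice_filter_def by blast
  then show thesis
    using P that by blast
qed

section \<open>Injectivity and \<alpha>-filters\<close>

lemma alpha_filter_if_inj_annihilator:
  assumes inj: "inj_on (annihilator L) (carrier L)" and F: "nearlattice_filter L F"
  shows "alpha_filter L F"
  unfolding alpha_filter_def
proof (intro conjI F ballI subsetI)
  fix a b
  assume aF: "a \<in> F" and bD: "b \<in> double_annihilator L a"
  have a: "a \<in> carrier L" and b: "b \<in> carrier L"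
    using nearlattice_filter_closed[OF F aF] bD by (simp_all add: double_annihilator_def)
  have sub: "x \<squnion> b = \<top>" if "x \<in> carrier L" "x \<squnion> a = \<top>" for x
    using bD that b by (auto simp: double_annihilator_def annihilator_def join_comm)
  have "x \<squnion> (a \<squnion> b) = \<top> \<longleftrightarrow> x \<squnion> b = \<top>" if x: "x \<in> carrier L" for x
  proof
    assume "x \<squnion> (a \<squnion> b) = \<top>"
    \<comment> \<open>So \<open>x \<squnion> b\<close> annihilates \<open>a\<close>, hence also
      \<open>b\<close>, and the second \<open>b\<close> is absorbed.\<close>
    then have "(x \<squnion> b) \<squnion> a = \<top>"
      using x a b by (metis join_assoc join_comm)
    then have "(x \<squnion> b) \<squnion> b = \<top>"
      using sub x b by simp
    then show "x \<squnion> b = \<top>"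
      using x b by (simp add: join_assoc join_absorb)
  next
    assume "x \<squnion> b = \<top>"
    then have "x \<squnion> (a \<squnion> b) = a \<squnion> \<top>"
      using x a b by (metis join_assoc join_comm)
    then show "x \<squnion> (a \<squnion> b) = \<top>"
      using a by (simp add: join_absorb)
  qed
  then have "annihilator L (a \<squnion> b) = annihilator L b"
    by (auto simp: annihilator_def)
  then have "a \<squnion> b = b"
    using inj a b by (simp add: inj_on_eq_iff)
  then have "a \<sqsubseteq> b"
    using a b by (metis join_left)
  then show "b \<in> F"
    using nearlattice_filter_upward[OF F aF b] by simp
qed

lemma inj_annihilator_if_prime_alpha:
  assumes "\<And>P. prime_nearlattice_filter L P \<Longrightarrow> alpha_filter L P"
  shows "inj_on (annihilator L) (carrier L)"
proof -
  have "a \<sqsubseteq> b" if c: "a \<in> carrier L" "b \<in> carrier L" and eq: "annihilator L a = annihilator L b" for a b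
  proof (rule ccontr)
    assume "\<not> a \<sqsubseteq> b"
    then obtain P where P: "prime_nearlattice_filter L P" "a \<in> P" "b \<notin> P"
      using prime_filter_separation c by blast
    \<comment> \<open>The double annihilator of \<open>a\<close> depends only on the annihilator of
      \<open>a\<close>, so it is that of \<open>b\<close>, which contains \<open>b\<close>.\<close>
    have "b \<in> double_annihilator L a"
      unfolding double_annihilator_def eq using c by (auto simp: annihilator_def join_comm)
    then show False
      using assms[OF P(1)] P(2,3) unfolding alpha_filter_def by blast
  qed
  \<comment> \<open>The inequality holds with \<open>a\<close> and \<open>b\<close> exchanged as
    well, so antisymmetry applies.\<close>
  then show ?thesis
    by (metis inj_onI le_antisym)
qed

end

theorem theorem2p12:
  fixes L :: "('a, 'b) gorder_scheme"
  assumes "distributive_nearlattice L"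
  shows "(inj_on (annihilator L) (carrier L)
            \<longleftrightarrow> (\<forall>F. nearlattice_filter L F \<longrightarrow> alpha_filter L F)) \<and>
         ((\<forall>F. nearlattice_filter L F \<longrightarrow> alpha_filter L F)
            \<longleftrightarrow> (\<forall>F. prime_nearlattice_filter L F \<longrightarrow> alpha_filter L F))"
proof -
  interpret distributive_nearlattice L by fact
  \<comment> \<open>The implications form a cycle; from all filters to prime filters is immediate,
    as prime filters are filters.\<close>
  show ?thesis
    using alpha_filter_if_inj_annihilator inj_annihilator_if_prime_alpha
    unfolding prime_nearlattice_filter_def by blast
qed

end
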